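(* For every $\alpha\in(0,2]$ and every $c>0$, the function $$G_{\alpha,c}(x)\;=\;\frac{1}{2\pi}\sum_{n\in\mathbb{Z}}\frac{\cos(nx)}{c+|n|^\alpha}$$ is completely monotone on $(0,\pi)$.
   Context: For $x\in(0,\pi)$ the series is understood as the limit of the symmetric partial sums $\frac{1}{2\pi}\sum_{|n|\le N}\frac{\cos(nx)}{c+|n|^\alpha}$ as $N\to\infty$ (the convergence is only conditional for $\alpha\le 1$); here $|0|^\alpha=0$. The function $G_{\alpha,c}$ is the Green function of the operator $c+(-\Delta)^{\alpha/2}$ on the periodic domain $[-\pi,\pi]$. A function $f$ on an open interval $I\subset\mathbb{R}$ is called completely monotone on $I$ if it is infinitely differentiable on $I$ and $(-1)^p f^{(p)}(x)\ge 0$ for every $x\in I$ and every integer $p\ge 0$. *)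

theory Defs
  imports "HOL-Analysis.Analysis"
begin

text \<open>The symmetric partial sums. The term \<open>n = 0\<close> equals \<open>1 / c\<close>, because \<open>0 powr \<alpha> = 0\<close>.\<close>

definition green_partial_sum :: "real \<Rightarrow> real \<Rightarrow> nat \<Rightarrow> real \<Rightarrow> real" where
  "green_partial_sum \<alpha> c N x =
     1 / (2 * pi) * (\<Sum>n = - int N..int N. cos (of_int n * x) / (c + \<bar>of_int n\<bar> powr \<alpha>))"

text \<open>For \<open>\<alpha> \<le> 1\<close> the series converges only conditionally, so the two-sided sum over the integers
  is a limit of symmetric partial sums and not an unordered sum. The limit exists on \<open>(0, \<pi>)\<close>.\<close>

definition green :: "real \<Rightarrow> real \<Rightarrow> real \<Rightarrow> real" where
  "green \<alpha> c x = lim (\<lambda>N. green_partial_sum \<alpha> c N x)"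

lemma green_partial_sum_convergent:
  assumes "0 < \<alpha>" and "0 < c" and "x \<in> {0<..<pi}"
  shows "convergent (\<lambda>N. green_partial_sum \<alpha> c N x)"
proof -
  define a where "a n = 1 / (c + real n powr \<alpha>)" for n
  define S where "S n = sin ((real n + 1 / 2) * x)" for n
  define s where "s = sin (x / 2)"
  have s: "s > 0"
    unfolding s_def using assms by (intro sin_gt_zero) auto
  have a_anti: "a (Suc n) \<le> a n" for n
    unfolding a_def using assms
    by (intro divide_left_mono add_left_mono powr_mono2 mult_pos_pos add_pos_nonneg) auto
  have a_lim: "a \<longlonglongrightarrow> 0"
  proof (rule Lim_null_comparison)
    show "(\<lambda>n. real n powr - \<alpha>) \<longlonglongrightarrow> 0"
      using assms by (intro tendsto_neg_powr filterlim_real_sequentially) auto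
    show "\<forall>\<^sub>F n in sequentially. norm (a n) \<le> real n powr - \<alpha>"
      using eventually_gt_at_top[of 0]
    proof eventually_elim
      case (elim n)
      then have "1 / (c + real n powr \<alpha>) \<le> 1 / real n powr \<alpha>"
        using assms by (intro divide_left_mono mult_pos_pos add_pos_pos) auto
      then show ?case
        using assms by (simp add: a_def powr_minus_divide)
    qed
  qed
  have S_bound: "\<bar>S n\<bar> \<le> 1" for n
    by (simp add: S_def)
  have cos_eq: "2 * s * cos (real (Suc n) * x) = S (Suc n) - S n" for n
  proof -
    have "(real (Suc n) + 1 / 2) * x = real (Suc n) * x + x / 2"
      and "(real n + 1 / 2) * x = real (Suc n) * x - x / 2"
      by (simp_all add: field_simps)
    then show ?thesis
      by (simp only: S_def s_def sin_add sin_diff) simp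
  qed
  have "(\<lambda>n. a n * S n) \<longlonglongrightarrow> 0"
  proof (rule Lim_null_comparison[OF _ a_lim])
    have "a n \<ge> 0" for n
      using assms by (simp add: a_def)
    then have "norm (a n * S n) \<le> a n" for n
      using mult_left_mono[OF S_bound, of "a n" n] by (simp add: abs_mult)
    then show "\<forall>\<^sub>F n in sequentially. norm (a n * S n) \<le> a n"
      by simp
  qed
  then have 1: "summable (\<lambda>n. a (Suc n) * S (Suc n) - a n * S n)"
    by (rule telescope_summable)
  have 2: "summable (\<lambda>n. (a n - a (Suc n)) * S n)"
  proof (rule summable_comparison_test'[OF telescope_summable'[OF a_lim]])
    show "norm ((a n - a (Suc n)) * S n) \<le> a n - a (Suc n)" for n
      using mult_left_mono[OF S_bound, of "a n - a (Suc n)" n] a_anti[of n]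
      by (simp add: abs_mult)
  qed
  have "summable (\<lambda>n. 1 / (2 * s) *
      ((a (Suc n) * S (Suc n) - a n * S n) + (a n - a (Suc n)) * S n))"
    by (intro summable_mult summable_add 1 2)
  also have "(\<lambda>n. 1 / (2 * s) *
      ((a (Suc n) * S (Suc n) - a n * S n) + (a n - a (Suc n)) * S n)) =
    (\<lambda>n. a (Suc n) * cos (real (Suc n) * x))"
  proof
    fix n
    have "(a (Suc n) * S (Suc n) - a n * S n) + (a n - a (Suc n)) * S n =
        a (Suc n) * (2 * s * cos (real (Suc n) * x))"
      unfolding cos_eq by (simp add: algebra_simps)
    then show "1 / (2 * s) * ((a (Suc n) * S (Suc n) - a n * S n) + (a n - a (Suc n)) * S n) =
        a (Suc n) * cos (real (Suc n) * x)"
      using s by simp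
  qed
  finally have conv: "convergent (\<lambda>N. \<Sum>n<N. a (Suc n) * cos (real (Suc n) * x))"
    by (simp add: summable_iff_convergent)
  have "green_partial_sum \<alpha> c N x =
      1 / (2 * pi) * (1 / c + 2 * (\<Sum>n<N. a (Suc n) * cos (real (Suc n) * x)))" for N
  proof -
    have "(\<Sum>n = - int N..int N. cos (of_int n * x) / (c + \<bar>of_int n\<bar> powr \<alpha>)) =
        1 / c + 2 * (\<Sum>n<N. a (Suc n) * cos (real (Suc n) * x))"
    proof (induction N)
      case 0
      then show ?case by simp
    next
      case (Suc N)
      let ?g = "\<lambda>n::int. cos (of_int n * x) / (c + \<bar>of_int n\<bar> powr \<alpha>)"
      have "{- int (Suc N)..int (Suc N)} =
          insert (- int (Suc N)) (insert (int (Suc N)) {- int N..int N})"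
        by auto
      then have "sum ?g {- int (Suc N)..int (Suc N)} =
          ?g (- int (Suc N)) + (?g (int (Suc N)) + sum ?g {- int N..int N})"
        by (simp del: of_nat_Suc)
      also have "?g (- int (Suc N)) = a (Suc N) * cos (real (Suc N) * x)"
        by (simp add: a_def del: of_nat_Suc)
      also have "?g (int (Suc N)) = a (Suc N) * cos (real (Suc N) * x)"
        by (simp add: a_def del: of_nat_Suc)
      finally show ?case
        unfolding Suc.IH by simp
    qed
    then show ?thesis
      by (simp add: green_partial_sum_def)
  qed
  moreover from conv have "convergent (\<lambda>N. 1 / (2 * pi) *
      (1 / c + 2 * (\<Sum>n<N. a (Suc n) * cos (real (Suc n) * x))))"
    by (intro convergent_mult convergent_add convergent_const)
  ultimately show ?thesis
    by simp
qed

text \<open>Meant for open \<open>I\<close>: the iterated derivatives are two-sided, and at a point of an open set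
  they do not depend on the values of \<open>f\<close> outside of it.\<close>

definition completely_monotone_on :: "real set \<Rightarrow> (real \<Rightarrow> real) \<Rightarrow> bool" where
  "completely_monotone_on I f \<longleftrightarrow>
     (\<forall>p. \<forall>x\<in>I. (deriv ^^ p) f differentiable at x) \<and>
     (\<forall>p. \<forall>x\<in>I. (-1) ^ p * (deriv ^^ p) f x \<ge> 0)"

end

theory Submission
  imports Defs "HOL-Complex_Analysis.Complex_Analysis" "HOL-Real_Asymp.Real_Asymp"
begin

text \<open>For \<open>\<alpha> = 2 b < 2\<close> the map \<open>l \<mapsto> 1 / (c + l powr b)\<close> is a Stieltjes function: it is a mixture of the
  kernels \<open>t / (t + l)\<close> over a nonnegative density in \<open>u = ln t\<close>. Hence \<open>green \<alpha> c\<close> is a mixture of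
  the Green functions for \<open>\<alpha> = 2\<close> and \<open>c = t\<close>, which are known in closed form. With \<open>s = sqrt t\<close> these
  are nonnegative multiples of \<open>exp (- s x) + exp (- s (2 \<pi> - x))\<close>. A mixture of such functions
  is \<open>L x + L (2 \<pi> - x)\<close> for a Laplace transform \<open>L\<close> of a nonnegative measure, and on
  \<open>(0, \<pi>)\<close> each derivative of the first summand dominates that of the second because
  \<open>x < 2 \<pi> - x\<close>.\<close>

section \<open>Laplace transforms\<close>

text \<open>Exhibiting a whole chain \<open>g\<close> of successive derivatives avoids handling
  iterated \<open>deriv\<close> directly. Since \<open>I\<close> is open, agreement on
  \<open>I\<close> is agreement near each point, so each derivative carries over to the next
  order.\<close>

lemma deriv_funpow_eq:
  fixes f :: "real \<Rightarrow> real" and g :: "nat \<Rightarrow> real \<Rightarrow> real"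
  assumes "open I" and "\<And>x. x \<in> I \<Longrightarrow> f x = g 0 x"
    and der: "\<And>p x. x \<in> I \<Longrightarrow> (g p has_real_derivative g (Suc p) x) (at x)"
    and "x \<in> I"
  shows "(deriv ^^ p) f x = g p x" and "(deriv ^^ p) f differentiable at x"
proof -
  have eq: "(deriv ^^ p) f x = g p x" if "x \<in> I" for p x
    using that
  proof (induction p arbitrary: x)
    case 0
    then show ?case
      using assms(2) by simp
  next
    case (Suc p)
    have "((deriv ^^ p) f has_real_derivative g (Suc p) x) (at x)"
      using der[OF Suc.prems] by (rule has_field_derivative_transform_within_open)
        (use assms(1) Suc in auto)
    then show ?case
      by (simp add: DERIV_imp_deriv)
  qed
  show "(deriv ^^ p) f x = g p x"
    using eq assms by blast
  have "((deriv ^^ p) f has_real_derivative g (Suc p) x) (at x)"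
    using der[OF assms(4)] by (rule has_field_derivative_transform_within_open)
      (use assms eq in auto)
  then show "(deriv ^^ p) f differentiable at x"
    using real_differentiable_def by blast
qed

text \<open>Second-order Taylor formula with Lagrange remainder, the factor 1/2 being given away. It
  controls the difference quotients of Laplace transforms.\<close>

lemma exp_remainder_quadratic: "\<bar>exp y - 1 - y\<bar> \<le> y\<^sup>2 * exp \<bar>y\<bar>" for y :: real
proof -
  obtain t where t: "\<bar>t\<bar> \<le> \<bar>y\<bar>" "exp y = (\<Sum>m<2. (y ^ m) / fact m) + (exp t / fact 2) * y ^ 2"
    using Maclaurin_exp_le[of y 2] by blast
  have "exp y - 1 - y = exp t / 2 * y\<^sup>2"
    using t(2) by (simp add: numeral_2_eq_2)
  then have "\<bar>exp y - 1 - y\<bar> = exp t / 2 * y\<^sup>2"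
    by (simp only: abs_mult) simp
  also have "\<dots> \<le> exp \<bar>y\<bar> * y\<^sup>2"
  proof -
    have "exp t \<le> exp \<bar>y\<bar>" "0 < exp t"
      using t(1) by auto
    then have "exp t / 2 \<le> exp \<bar>y\<bar>"
      by linarith
    then show ?thesis
      by (intro mult_right_mono) auto
  qed
  finally show ?thesis
    by (simp add: mult.commute)
qed

text \<open>Up to the sign \<open>(-1) ^ p\<close>, this is the \<open>p\<close>-th derivative of
  the Laplace transform of the image under \<open>s\<close> of the measure with density
  \<open>w\<close>. Without the sign it is nonnegative and decreasing in \<open>x > 0\<close>
  whenever \<open>w\<close> and \<open>s\<close> are nonnegative.\<close>

definition laplace_moment :: "'a measure \<Rightarrow> ('a \<Rightarrow> real) \<Rightarrow> ('a \<Rightarrow> real) \<Rightarrow> nat \<Rightarrow> real \<Rightarrow> real" where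
  "laplace_moment M w s p x = (\<integral>u. w u * s u ^ p * exp (- (s u * x)) \<partial>M)"

context
  fixes M :: "'a measure" and w s :: "'a \<Rightarrow> real"
  assumes measurable [measurable]: "w \<in> borel_measurable M" "s \<in> borel_measurable M"
    and s_nonneg: "\<And>u. s u \<ge> 0"
    and integrable: "\<And>x. x > 0 \<Longrightarrow> integrable M (\<lambda>u. w u * exp (- (s u * x)))"
begin

text \<open>Half of the exponential pays for one more power of \<open>s\<close>:
  \<open>s u * exp (- (s u * x / 2))\<close> is at most \<open>2 / x\<close>. The induction
  therefore passes from \<open>x\<close> to \<open>x / 2\<close>.\<close>

lemma laplace_moment_integrable:
  "x > 0 \<Longrightarrow> integrable M (\<lambda>u. w u * s u ^ p * exp (- (s u * x)))"
proof (induction p arbitrary: x)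
  case 0
  then show ?case
    using integrable by simp
next
  case (Suc p)
  have "integrable M (\<lambda>u. (2 / x) * (w u * s u ^ p * exp (- (s u * (x / 2)))))"
    using Suc.IH[of "x / 2"] Suc.prems by simp
  then show ?case
  proof (rule Bochner_Integration.integrable_bound)
    show "AE u in M. norm (w u * s u ^ Suc p * exp (- (s u * x)))
        \<le> norm ((2 / x) * (w u * s u ^ p * exp (- (s u * (x / 2)))))"
    proof (rule AE_I2)
      fix u
      have "s u * (x / 2) \<le> exp (s u * (x / 2))"
        using exp_ge_add_one_self[of "s u * (x / 2)"] by linarith
      then have "s u \<le> (2 / x) * exp (s u * (x / 2))"
        using Suc.prems by (simp add: field_simps)
      then have "s u * exp (- (s u * x)) \<le> (2 / x) * exp (s u * (x / 2)) * exp (- (s u * x))"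
        by (intro mult_right_mono) auto
      also have "\<dots> = (2 / x) * exp (- (s u * (x / 2)))"
        by (simp add: mult_exp_exp)
      finally have "\<bar>w u\<bar> * s u ^ p * (s u * exp (- (s u * x)))
          \<le> \<bar>w u\<bar> * s u ^ p * ((2 / x) * exp (- (s u * (x / 2))))"
        using s_nonneg by (intro mult_left_mono) auto
      then show "norm (w u * s u ^ Suc p * exp (- (s u * x)))
        \<le> norm ((2 / x) * (w u * s u ^ p * exp (- (s u * (x / 2)))))"
        using s_nonneg[of u] Suc.prems by (simp add: abs_mult mult_ac power_abs)
    qed
  qed measurable
qed

text \<open>The quadratic remainder of the exponential, integrated against the measure, bounds the
  error of the difference quotient by a constant times the modulus of the increment.\<close>

lemma laplace_moment_has_derivative:
  assumes "x > 0"
  shows "(laplace_moment M w s p has_real_derivative - laplace_moment M w s (Suc p) x) (at x)"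
proof -
  let ?f = "\<lambda>q x u. w u * s u ^ q * exp (- (s u * x))"
  \<comment> \<open>The remainder brings in \<open>s u ^ 2\<close> and, for increments below
    \<open>x / 2\<close>, a factor of at most \<open>exp (s u * (x / 2))\<close>. Hence the order
    \<open>p + 2\<close> and the argument \<open>x / 2\<close>.\<close>
  define C where "C = (\<integral>u. \<bar>?f (p + 2) (x / 2) u\<bar> \<partial>M)"
  have bound: "\<bar>(laplace_moment M w s p (x + h) - laplace_moment M w s p x) / h
      - (- laplace_moment M w s (Suc p) x)\<bar> \<le> C * \<bar>h\<bar>" if h: "h \<noteq> 0" "\<bar>h\<bar> < x / 2" for h
  proof -
    have xh: "x + h > 0"
      using h assms by linarith
    note int = laplace_moment_integrable[OF xh, of p] laplace_moment_integrable[OF assms]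
    have C_int: "integrable M (\<lambda>u. \<bar>?f (p + 2) (x / 2) u\<bar>)"
      using assms by (intro integrable_abs laplace_moment_integrable) auto
    have pt: "\<bar>?f p (x + h) u - ?f p x u + h * ?f (Suc p) x u\<bar> \<le> h\<^sup>2 * \<bar>?f (p + 2) (x / 2) u\<bar>" for u
    proof -
      have "exp (- (s u * (x + h))) = exp (- (s u * x)) * exp (- (s u * h))"
        by (simp add: mult_exp_exp algebra_simps)
      then have "?f p (x + h) u - ?f p x u + h * ?f (Suc p) x u
          = ?f p x u * (exp (- (s u * h)) - 1 - (- (s u * h)))"
        by (simp only:) (simp add: algebra_simps)
      then have "\<bar>?f p (x + h) u - ?f p x u + h * ?f (Suc p) x u\<bar>
          = \<bar>?f p x u\<bar> * \<bar>exp (- (s u * h)) - 1 - (- (s u * h))\<bar>"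
        by (simp only: abs_mult)
      also have "\<dots> \<le> \<bar>?f p x u\<bar> * ((- (s u * h))\<^sup>2 * exp \<bar>- (s u * h)\<bar>)"
        by (intro mult_left_mono exp_remainder_quadratic) auto
      also have "\<dots> \<le> \<bar>?f p x u\<bar> * ((- (s u * h))\<^sup>2 * exp (s u * (x / 2)))"
      proof -
        have "s u * \<bar>h\<bar> \<le> s u * (x / 2)"
          using h s_nonneg[of u] by (intro mult_left_mono) auto
        then show ?thesis
          using s_nonneg[of u] by (intro mult_left_mono) (auto simp: abs_mult)
      qed
      also have "\<dots> = h\<^sup>2 * \<bar>?f (p + 2) (x / 2) u\<bar>"
      proof -
        have "exp (- (s u * x)) * exp (s u * (x / 2)) = exp (- (s u * (x / 2)))"
          by (simp add: mult_exp_exp)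
        then have "\<bar>w u\<bar> * s u ^ p * (s u * h)\<^sup>2 * (exp (- (s u * x)) * exp (s u * (x / 2)))
            = h\<^sup>2 * (\<bar>w u\<bar> * s u ^ (p + 2) * exp (- (s u * (x / 2))))"
          by (simp add: power2_eq_square algebra_simps)
        then show ?thesis
          using s_nonneg[of u] by (simp add: abs_mult power_abs mult_ac)
      qed
      finally show ?thesis .
    qed
    have "\<bar>laplace_moment M w s p (x + h) - laplace_moment M w s p x + h * laplace_moment M w s (Suc p) x\<bar>
        = \<bar>\<integral>u. ?f p (x + h) u - ?f p x u + h * ?f (Suc p) x u \<partial>M\<bar>"
    proof -
      have "has_bochner_integral M (\<lambda>u. ?f p (x + h) u - ?f p x u + h * ?f (Suc p) x u)
          (laplace_moment M w s p (x + h) - laplace_moment M w s p x + h * laplace_moment M w s (Suc p) x)"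
        unfolding laplace_moment_def using int
        by (intro has_bochner_integral_add has_bochner_integral_diff
            has_bochner_integral_mult_right has_bochner_integral_integrable) (auto simp del: power_Suc)
      then show ?thesis
        by (simp only: has_bochner_integral_integral_eq)
    qed
    also have "\<dots> \<le> (\<integral>u. h\<^sup>2 * \<bar>?f (p + 2) (x / 2) u\<bar> \<partial>M)"
    proof (rule order_trans[OF integral_abs_bound integral_mono])
      show "integrable M (\<lambda>u. \<bar>?f p (x + h) u - ?f p x u + h * ?f (Suc p) x u\<bar>)"
        using int by (intro integrable_abs Bochner_Integration.integrable_add
            Bochner_Integration.integrable_diff integrable_mult_right) (auto simp del: power_Suc)
      show "integrable M (\<lambda>u. h\<^sup>2 * \<bar>?f (p + 2) (x / 2) u\<bar>)"
        using C_int by (rule integrable_mult_right)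
    qed (rule pt)
    also have "\<dots> = h\<^sup>2 * C"
      by (simp add: C_def)
    finally have "\<bar>laplace_moment M w s p (x + h) - laplace_moment M w s p x + h * laplace_moment M w s (Suc p) x\<bar> / \<bar>h\<bar>
        \<le> h\<^sup>2 * C / \<bar>h\<bar>"
      by (intro divide_right_mono) auto
    also have "h\<^sup>2 * C / \<bar>h\<bar> = C * \<bar>h\<bar>"
      using h by (simp add: power2_eq_square field_simps abs_if)
    finally show ?thesis
      using h by (simp add: field_simps flip: abs_divide)
  qed
  show ?thesis
    unfolding DERIV_def
  proof (rule LIM_zero_cancel, rule Lim_null_comparison)
    show "\<forall>\<^sub>F h in at 0. norm ((laplace_moment M w s p (x + h) - laplace_moment M w s p x) / h
      - (- laplace_moment M w s (Suc p) x)) \<le> C * \<bar>h\<bar>"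
      unfolding eventually_at using assms bound
      by (intro exI[of _ "x / 2"]) (auto simp: dist_norm)
    show "((\<lambda>h. C * \<bar>h\<bar>) \<longlongrightarrow> 0) (at 0)"
      by (auto intro!: tendsto_eq_intros)
  qed
qed

lemma completely_monotone_on_laplace_symmetrized:
  assumes w_nonneg: "\<And>u. w u \<ge> 0"
    and f: "\<And>x. 0 < x \<Longrightarrow> x < a \<Longrightarrow>
      f x = (\<integral>u. w u * (exp (- (s u * x)) + exp (- (s u * (2 * a - x)))) \<partial>M)"
  shows "completely_monotone_on {0<..<a} f"
proof -
  define L where "L = laplace_moment M w s"
  \<comment> \<open>Differentiating the reflected summand yields a second sign from the inner
    function \<open>2 * a - x\<close>, so only the first summand alternates.\<close>
  define g where "g p x = (-1) ^ p * L p x + L p (2 * a - x)" for p x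
  have der: "(g p has_real_derivative g (Suc p) x) (at x)" if "x \<in> {0<..<a}" for p x
  proof -
    have "((\<lambda>x. L p (2 * a - x)) has_real_derivative - L (Suc p) (2 * a - x) * (- 1)) (at x)"
      unfolding L_def using that
      by (intro DERIV_chain'[where f = "\<lambda>x. 2 * a - x"] laplace_moment_has_derivative)
        (auto intro!: derivative_eq_intros)
    moreover have "(L p has_real_derivative - L (Suc p) x) (at x)"
      unfolding L_def using that by (intro laplace_moment_has_derivative) auto
    ultimately show ?thesis
      unfolding g_def by (auto intro!: derivative_eq_intros)
  qed
  have f0: "f x = g 0 x" if "x \<in> {0<..<a}" for x
    using that integrable[of x] integrable[of "2 * a - x"]
    by (simp add: f g_def L_def laplace_moment_def distrib_left)
  have mono: "0 \<le> L p y" "L p y \<le> L p x" if "0 < x" "x \<le> y" for p x y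
  proof -
    show "0 \<le> L p y"
      using w_nonneg s_nonneg by (auto simp: L_def laplace_moment_def intro!: integral_nonneg)
    show "L p y \<le> L p x"
      unfolding L_def laplace_moment_def using that w_nonneg s_nonneg
      by (intro integral_mono laplace_moment_integrable mult_left_mono) (auto intro: mult_left_mono)
  qed
  have "0 \<le> (-1) ^ p * g p x" if "x \<in> {0<..<a}" for p x
  proof -
    have "(-1) ^ p * g p x = L p x + (-1) ^ p * L p (2 * a - x)"
      by (simp add: g_def algebra_simps flip: power_add mult_2)
    moreover have "\<bar>(-1) ^ p * L p (2 * a - x)\<bar> \<le> L p x"
      using mono[of x "2 * a - x" p] that by (simp add: abs_mult power_abs)
    ultimately show ?thesis
      by linarith
  qed
  then show ?thesis
    unfolding completely_monotone_on_def
    using deriv_funpow_eq[of "{0<..<a}" f g, OF _ f0 der] by simp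
qed

end

section \<open>The cosine series of the hyperbolic cosine\<close>

text \<open>Completeness of the cosines: vanishing coefficients make \<open>f\<close> orthogonal to
  every polynomial in \<open>cos x\<close>, and by Weierstrass these approximate \<open>f\<close>
  uniformly. So \<open>f\<close> is orthogonal to itself.\<close>

lemma continuous_zero_cosine_coefficients_imp_zero:
  fixes f :: "real \<Rightarrow> real"
  assumes cont: "continuous_on {0..pi} f"
    and coeff: "\<And>n. integral {0..pi} (\<lambda>x. f x * cos (real n * x)) = 0"
    and "x \<in> {0..pi}"
  shows "f x = 0"
proof -
  have moment: "integral {0..pi} (\<lambda>x. f x * cos x ^ k * cos (real n * x)) = 0" for k n
  proof (induction k arbitrary: n)
    case 0
    then show ?case
      using coeff by simp
  next
    case (Suc k)
    \<comment> \<open>For \<open>n = 0\<close> the product formula has frequency -1. Subtraction on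
      naturals would give 0 there, so evenness of the cosine is used to write 1 instead.\<close>
    have cos_cos: "cos x * cos (real n * x)
        = (cos (real (Suc n) * x) + cos (real (if n = 0 then 1 else n - 1) * x)) / 2" for x
    proof -
      have "real (Suc n) * x = real n * x + x" 
        by (simp add: algebra_simps)
      moreover have "cos (real (if n = 0 then 1 else n - 1) * x) = cos (real n * x - x)"
        by (cases n) (simp_all add: algebra_simps)
      ultimately show ?thesis
        by (simp only: cos_add cos_diff) simp
    qed
    have "integral {0..pi} (\<lambda>x. f x * cos x ^ Suc k * cos (real n * x))
      = integral {0..pi} (\<lambda>x. (f x * cos x ^ k * cos (real (Suc n) * x)
        + f x * cos x ^ k * cos (real (if n = 0 then 1 else n - 1) * x)) / 2)"
    proof (rule arg_cong[where f = "integral {0..pi}"], rule ext)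
      fix x
      have "f x * cos x ^ Suc k * cos (real n * x) = f x * cos x ^ k * (cos x * cos (real n * x))"
        by simp
      then show "f x * cos x ^ Suc k * cos (real n * x) = (f x * cos x ^ k * cos (real (Suc n) * x)
          + f x * cos x ^ k * cos (real (if n = 0 then 1 else n - 1) * x)) / 2"
        unfolding cos_cos by (simp only: distrib_left times_divide_eq_right)
    qed
    also have "\<dots> = 0"
      using cont Suc by (subst integral_divide, subst Henstock_Kurzweil_Integration.integral_add)
        (auto intro!: integrable_continuous_interval continuous_intros simp del: of_nat_Suc)
    finally show ?case .
  qed
  define C where "C = integral {0..pi} (\<lambda>x. \<bar>f x\<bar>)"
  have sq_int: "(\<lambda>x. f x * f x) integrable_on {0..pi}" and abs_int: "(\<lambda>x. \<bar>f x\<bar>) integrable_on {0..pi}"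
    using cont by (auto intro!: integrable_continuous_interval continuous_intros)
  have C: "C \<ge> 0"
    unfolding C_def using abs_int by (intro integral_nonneg) auto
  \<comment> \<open>With \<open>p (cos x)\<close> uniformly within \<open>e\<close> of
    \<open>f x\<close>, the integral of \<open>f x * f x\<close> equals that of
    \<open>f x * (f x - p (cos x))\<close>, which is at most \<open>e * C\<close>.\<close>
  have small: "integral {0..pi} (\<lambda>x. f x * f x) \<le> e * C" if "e > 0" for e
  proof -
    have arc: "continuous_on {-1..1} (\<lambda>y. f (arccos y))"
      by (rule continuous_on_compose2[OF cont continuous_on_arccos'])
        (auto intro: arccos_lbound arccos_ubound)
    obtain p :: "real \<Rightarrow> real" where p: "real_polynomial_function p"
        "\<And>y. y \<in> {-1..1} \<Longrightarrow> \<bar>f (arccos y) - p y\<bar> < e"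
      using Stone_Weierstrass_real_polynomial_function[OF compact_Icc arc \<open>e > 0\<close>] by auto
    obtain a n where a: "p = (\<lambda>x. \<Sum>i\<le>n. a i * x ^ i)"
      using p(1) real_polynomial_function_iff_sum by blast
    have "(\<lambda>x. f x * cos x ^ i) integrable_on {0..pi}" for i
      using cont by (intro integrable_continuous_interval continuous_intros)
    then have "((\<lambda>x. \<Sum>i\<le>n. a i * (f x * cos x ^ i)) has_integral (\<Sum>i\<le>n. a i * 0)) {0..pi}"
      using moment[of _ 0] by (intro has_integral_sum has_integral_mult_right)
        (auto simp: has_integral_iff)
    moreover have "(\<lambda>x. \<Sum>i\<le>n. a i * (f x * cos x ^ i)) = (\<lambda>x. f x * p (cos x))"
      by (simp add: a sum_distrib_left mult_ac)
    ultimately have p0: "((\<lambda>x. f x * p (cos x)) has_integral 0) {0..pi}"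
      by simp
    have "integral {0..pi} (\<lambda>x. f x * f x) = integral {0..pi} (\<lambda>x. f x * f x - f x * p (cos x))"
      using sq_int p0 by (simp add: Henstock_Kurzweil_Integration.integral_diff has_integral_iff)
    also have "\<dots> \<le> integral {0..pi} (\<lambda>x. e * \<bar>f x\<bar>)"
    proof (rule integral_le)
      show "(\<lambda>x. f x * f x - f x * p (cos x)) integrable_on {0..pi}"
        using sq_int p0 by (intro integrable_diff) auto
      show "(\<lambda>x. e * \<bar>f x\<bar>) integrable_on {0..pi}"
        using abs_int by (intro integrable_on_mult_right)
      fix x :: real assume x: "x \<in> {0..pi}"
      have "\<bar>f x - p (cos x)\<bar> \<le> e"
        using p(2)[of "cos x"] x by (simp add: arccos_cos)
      then have "\<bar>f x\<bar> * \<bar>f x - p (cos x)\<bar> \<le> \<bar>f x\<bar> * e"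
        by (intro mult_left_mono) auto
      then have "f x * (f x - p (cos x)) \<le> \<bar>f x\<bar> * e"
        using abs_ge_self[of "f x * (f x - p (cos x))"] by (simp only: abs_mult)
      then show "f x * f x - f x * p (cos x) \<le> e * \<bar>f x\<bar>"
        by (simp add: algebra_simps)
    qed
    finally show ?thesis
      by (simp add: C_def)
  qed
  have "integral {0..pi} (\<lambda>x. f x * f x) \<le> 0"
  proof (rule field_le_epsilon)
    fix d :: real assume "d > 0"
    \<comment> \<open>Taking \<open>e = d / (C + 1)\<close> rather than \<open>d / C\<close> covers
      the case \<open>C = 0\<close>.\<close>
    then have "integral {0..pi} (\<lambda>x. f x * f x) \<le> d / (C + 1) * C"
      using C by (intro small) auto
    also have "\<dots> \<le> d"
      using C \<open>d > 0\<close> by (simp add: field_simps)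
    finally show "integral {0..pi} (\<lambda>x. f x * f x) \<le> 0 + d"
      by simp
  qed
  moreover have "integral {0..pi} (\<lambda>x. f x * f x) \<ge> 0"
    using sq_int by (intro integral_nonneg) auto
  ultimately have "\<forall>x\<in>{0..pi}. f x * f x = 0"
    using cont by (subst integral_eq_0_iff[symmetric]) (auto intro!: continuous_intros)
  then show ?thesis
    using assms(3) by auto
qed

text \<open>The product is the mean of the cosines with frequencies \<open>n - m\<close> and
  \<open>n + m\<close>, taken over the integers because the difference can be negative. Only
  frequency 0 has a nonzero integral, and for \<open>m = n = 0\<close> both frequencies are
  0.\<close>

lemma cos_mult_cos_has_integral:
  fixes m n :: nat
  shows "((\<lambda>x. cos (real n * x) * cos (real m * x)) has_integral
    (if m = n then (if n = 0 then pi else pi / 2) else 0)) {0..pi}"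
proof -
  have cos_int: "((\<lambda>x. cos (of_int k * x)) has_integral (if k = 0 then pi else 0)) {0..pi}" for k :: int
  proof (cases "k = 0")
    case True
    then show ?thesis
      using has_integral_const_real[of "1 :: real" 0 pi] by simp
  next
    case False
    have "((\<lambda>x. cos (of_int k * x)) has_integral
        (sin (of_int k * pi) / of_int k - sin (of_int k * 0) / of_int k)) {0..pi}"
      using False by (intro fundamental_theorem_of_calculus)
        (auto intro!: derivative_eq_intros simp flip: has_real_derivative_iff_has_vector_derivative)
    moreover have "sin (of_int k * pi) = 0"
      using sin_zero_iff_int2 by blast
    ultimately show ?thesis
      using False by simp
  qed
  have eq: "(\<lambda>x. cos (real n * x) * cos (real m * x))
      = (\<lambda>x. (cos (of_int (int n - int m) * x) + cos (of_int (int n + int m) * x)) / 2)"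
    by (simp only: cos_times_cos left_diff_distrib distrib_right of_int_diff of_int_add of_int_of_nat_eq)
  show ?thesis
    unfolding eq
    using has_integral_divide[OF has_integral_add[OF cos_int[of "int n - int m"] cos_int[of "int n + int m"]], of 2]
    by (rule has_integral_eq_rhs) auto
qed

text \<open>Multiplicity of \<open>\<bar>n\<bar>\<close> when a sum over the integers is folded onto the naturals.\<close>

definition cosine_weight :: "nat \<Rightarrow> real" where
  "cosine_weight n = (if n = 0 then 1 else 2)"

lemma cosh_has_cosine_coefficients:
  fixes s :: real and m :: nat
  assumes "s > 0"
  shows "((\<lambda>x. cosh (s * (pi - x)) * cos (real m * x)) has_integral
    (s * sinh (s * pi) / (s\<^sup>2 + (real m)\<^sup>2))) {0..pi}"
proof -
  \<comment> \<open>An antiderivative found by integrating by parts twice. At \<open>pi\<close> both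
    terms vanish, since \<open>sinh 0 = 0\<close> and \<open>sin (m * pi) = 0\<close>.\<close>
  define F where "F x = (- s * sinh (s * (pi - x)) * cos (real m * x)
    + real m * cosh (s * (pi - x)) * sin (real m * x)) / (s\<^sup>2 + (real m)\<^sup>2)" for x
  have pos: "s\<^sup>2 + (real m)\<^sup>2 > 0"
    using assms by (simp add: add_pos_nonneg)
  have "(F has_real_derivative cosh (s * (pi - x)) * cos (real m * x)) (at x within {0..pi})" for x
  proof -
    have "((\<lambda>x. - s * sinh (s * (pi - x)) * cos (real m * x) + real m * cosh (s * (pi - x)) * sin (real m * x))
        has_real_derivative ((s\<^sup>2 + (real m)\<^sup>2) * (cosh (s * (pi - x)) * cos (real m * x))))
        (at x within {0..pi})"
      by (auto intro!: derivative_eq_intros simp: algebra_simps power2_eq_square)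
    then have "(F has_real_derivative ((s\<^sup>2 + (real m)\<^sup>2) * (cosh (s * (pi - x)) * cos (real m * x)))
        / (s\<^sup>2 + (real m)\<^sup>2)) (at x within {0..pi})"
      unfolding F_def by (rule DERIV_cdivide)
    moreover have "(s\<^sup>2 + (real m)\<^sup>2) * t / (s\<^sup>2 + (real m)\<^sup>2) = t" for t
      using assms by simp
    ultimately show ?thesis
      by (simp only:)
  qed
  then have "((\<lambda>x. cosh (s * (pi - x)) * cos (real m * x)) has_integral (F pi - F 0)) {0..pi}"
    by (intro fundamental_theorem_of_calculus)
      (auto simp flip: has_real_derivative_iff_has_vector_derivative)
  moreover have "F pi - F 0 = s * sinh (s * pi) / (s\<^sup>2 + (real m)\<^sup>2)"
    using sin_npi[of m] by (simp add: F_def)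
  ultimately show ?thesis
    by simp
qed

text \<open>The series converges uniformly by the M-test, so its sum \<open>H\<close> is continuous
  and its cosine coefficients can be computed termwise. They agree with those of the closed form
  \<open>K\<close>, and completeness of the cosines gives equality at every point, endpoints
  included.\<close>

lemma cosh_cosine_series:
  fixes s :: real
  assumes s: "s > 0" and x: "x \<in> {0..pi}"
  shows "(\<lambda>n. cosine_weight n * cos (real n * x) / (s\<^sup>2 + (real n)\<^sup>2))
    sums (pi * cosh (s * (pi - x)) / (s * sinh (s * pi)))"
proof -
  define h where "h n x = cosine_weight n * cos (real n * x) / (s\<^sup>2 + (real n)\<^sup>2)" for n x
  define K where "K x = pi * cosh (s * (pi - x)) / (s * sinh (s * pi))" for x
  define H where "H x = (\<Sum>n. h n x)" for x
  have bound: "norm (h n x) \<le> 2 / (s\<^sup>2 + (real n)\<^sup>2)" for n x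
    using abs_cos_le_one[of "real n * x"] s
    by (auto simp: h_def cosine_weight_def abs_mult add_pos_nonneg intro!: divide_right_mono)
  have summable: "summable (\<lambda>n. 2 / (s\<^sup>2 + (real n)\<^sup>2))"
  proof (rule summable_comparison_test_ev)
    show "summable (\<lambda>n. 2 * inverse (real n ^ 2))"
      by (intro summable_mult inverse_power_summable) auto
    show "\<forall>\<^sub>F n in sequentially. norm (2 / (s\<^sup>2 + (real n)\<^sup>2)) \<le> 2 * inverse (real n ^ 2)"
      using eventually_gt_at_top[of 0]
    proof eventually_elim
      case (elim n)
      then show ?case
        using s by (simp add: field_simps add_pos_pos)
    qed
  qed
  have unif: "uniform_limit {0..pi} (\<lambda>N x. \<Sum>n<N. h n x) H sequentially"
    unfolding H_def using bound summable by (rule Weierstrass_m_test)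
  have h_cont: "continuous_on A (h n)" for A n
    unfolding h_def using s by (intro continuous_intros) (auto simp: add_pos_nonneg less_imp_neq[THEN not_sym])
  have H_cont: "continuous_on {0..pi} H"
    using unif by (rule uniform_limit_theorem[rotated]) (auto intro!: always_eventually continuous_on_sum h_cont)
  have K_cont: "continuous_on A K" for A
    unfolding K_def by (intro continuous_intros) (use s in auto)
  have "K x - H x = 0"
  proof (rule continuous_zero_cosine_coefficients_imp_zero[where f = "\<lambda>x. K x - H x", OF _ _ x])
    show "continuous_on {0..pi} (\<lambda>x. K x - H x)"
      by (intro continuous_intros K_cont H_cont)
    fix m
    have "uniform_limit {0..pi} (\<lambda>N x. (\<Sum>n<N. h n x) * cos (real m * x)) (\<lambda>x. H x * cos (real m * x)) sequentially"
    proof (rule uniform_lim_mult[OF unif uniform_limit_const])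
      show "bounded (H ` {0..pi})"
        using H_cont by (intro compact_imp_bounded compact_continuous_image) auto
      show "bounded ((\<lambda>x. cos (real m * x)) ` {0..pi})"
        by (rule boundedI[of _ 1]) auto
    qed
    then obtain I J where I: "\<And>N. ((\<lambda>x. (\<Sum>n<N. h n x) * cos (real m * x)) has_integral I N) {0..pi}"
      and J: "((\<lambda>x. H x * cos (real m * x)) has_integral J) {0..pi}" and lim: "I \<longlonglongrightarrow> J"
      by (rule uniform_limit_integral) (auto intro!: continuous_intros h_cont)
    \<comment> \<open>Orthogonality leaves only the term \<open>n = m\<close>. The factor
      \<open>cosine_weight m\<close> compensates for the two different norms, so the numerator is
      \<open>pi\<close> for every \<open>m\<close>.\<close>
    have "I N = pi / (s\<^sup>2 + (real m)\<^sup>2)" if "N > m" for N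
    proof -
      define c where "c n = cosine_weight n / (s\<^sup>2 + (real n)\<^sup>2)" for n
      define d where "d n = (if m = n then (if n = 0 then pi else pi / 2) else 0)" for n
      have "((\<lambda>x. \<Sum>n<N. c n * (cos (real n * x) * cos (real m * x))) has_integral (\<Sum>n<N. c n * d n)) {0..pi}"
        unfolding d_def by (intro has_integral_sum has_integral_mult_right cos_mult_cos_has_integral) auto
      moreover have "(\<lambda>x. \<Sum>n<N. c n * (cos (real n * x) * cos (real m * x)))
          = (\<lambda>x. (\<Sum>n<N. h n x) * cos (real m * x))"
        by (auto simp: c_def h_def sum_distrib_right intro!: ext sum.cong)
      moreover have "(\<Sum>n<N. c n * d n) = (\<Sum>n\<in>{m}. c n * d n)"
        using that by (intro sum.mono_neutral_right) (auto simp: d_def)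
      ultimately have "((\<lambda>x. (\<Sum>n<N. h n x) * cos (real m * x)) has_integral c m * d m) {0..pi}"
        by simp
      with I[of N] have "I N = c m * d m"
        by (rule has_integral_unique)
      then show ?thesis
        by (simp add: c_def d_def cosine_weight_def)
    qed
    then have "I \<longlonglongrightarrow> pi / (s\<^sup>2 + (real m)\<^sup>2)"
      by (intro tendsto_eventually eventually_mono[OF eventually_gt_at_top[of m]]) auto
    then have J_eq: "J = pi / (s\<^sup>2 + (real m)\<^sup>2)"
      using lim LIMSEQ_unique by blast
    have "sinh (s * pi) > 0"
      using s by (simp add: sinh_real_pos_iff)
    have "((\<lambda>x. pi / (s * sinh (s * pi)) * (cosh (s * (pi - x)) * cos (real m * x))) has_integral
        (pi / (s * sinh (s * pi)) * (s * sinh (s * pi) / (s\<^sup>2 + (real m)\<^sup>2)))) {0..pi}"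
      by (intro has_integral_mult_right cosh_has_cosine_coefficients s)
    then have "((\<lambda>x. K x * cos (real m * x)) has_integral J) {0..pi}"
      using s \<open>sinh (s * pi) > 0\<close> by (simp add: K_def J_eq mult_ac)
    then have "((\<lambda>x. K x * cos (real m * x) - H x * cos (real m * x)) has_integral (J - J)) {0..pi}"
      using J by (rule has_integral_diff)
    then show "integral {0..pi} (\<lambda>x. (K x - H x) * cos (real m * x)) = 0"
      by (simp add: left_diff_distrib integral_unique)
  qed
  moreover have "summable (\<lambda>n. h n x)"
    using summable bound by (rule summable_comparison_test')
  ultimately show ?thesis
    using summable_sums by (fastforce simp: H_def h_def K_def)
qed

section \<open>The Stieltjes representation\<close>

text \<open>A zero would make \<open>exp z\<close> the negative number \<open>- c\<close>, which
  forces \<open>Im z\<close> to be an odd multiple of \<open>pi\<close>.\<close>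

lemma of_real_plus_exp_nonzero:
  assumes "c > 0" and "\<bar>Im z\<bar> < pi"
  shows "of_real c + exp z \<noteq> 0"
proof
  assume *: "of_real c + exp z = 0"
  then have "Im (of_real c + exp z) = 0" "Re (of_real c + exp z) = 0"
    by simp_all
  then have "sin (Im z) = 0" and re: "c + exp (Re z) * cos (Im z) = 0"
    by (simp_all add: Re_exp Im_exp)
  then have "Im z = 0"
    using assms(2) sin_eq_0_pi by auto
  then show False
    using re assms(1) by (smt (verit) cos_zero exp_gt_zero mult_cancel_left2 mult.right_neutral)
qed

text \<open>The jump of \<open>1 / (c + z powr b)\<close> across the negative real axis at \<open>- exp u\<close>, divided by
  \<open>2 \<pi> \<i>\<close>.\<close>

definition stieltjes_density :: "real \<Rightarrow> real \<Rightarrow> real \<Rightarrow> real" where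
  "stieltjes_density b c u = Im (1 / (of_real c + exp (Complex (b * u) (- (b * pi))))) / pi"

context
  fixes b c :: real
  assumes b: "0 < b" "b < 1" and c: "0 < c"
begin

text \<open>Taking the reciprocal flips the sign of the imaginary part, which for the denominator is
  \<open>- exp (b * u) * sin (b * pi)\<close>. For \<open>b\<close> between 0 and 1 this sine is
  nonnegative.\<close>

lemma stieltjes_density_nonneg: "0 \<le> stieltjes_density b c u"
proof -
  have "0 \<le> sin (b * pi)"
    using b by (intro sin_ge_zero) auto
  then show ?thesis
    unfolding stieltjes_density_def Im_divide
    by (auto simp: Im_exp intro!: divide_nonneg_nonneg)
qed

lemma continuous_on_stieltjes_density: "continuous_on A (stieltjes_density b c)"
proof -
  have "of_real c + exp (Complex (b * u) (- (b * pi))) \<noteq> 0" for u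
    using b c by (intro of_real_plus_exp_nonzero) (auto simp: abs_mult)
  then show ?thesis
    unfolding stieltjes_density_def Complex_eq by (intro continuous_intros) auto
qed

lemma borel_measurable_stieltjes_density [measurable]:
  "stieltjes_density b c \<in> borel_measurable borel"
  by (rule borel_measurable_continuous_onI) (rule continuous_on_stieltjes_density)

lemma stieltjes_truncated_integral_tendsto:
  fixes v :: real
  shows "(\<lambda>n. integral {- real n..real n} (\<lambda>u. stieltjes_density b c u / (1 + exp (v - u))))
    \<longlonglongrightarrow> 1 / (c + exp (b * v))"
proof -
  \<comment> \<open>\<open>z = \<i> w\<close>, where \<open>w\<close> is the logarithm of the Stieltjes variable: the slit plane becomes the
    strip \<open>\<bar>Re z\<bar> < \<pi>\<close>, and \<open>f / g\<close> has its only pole there at \<open>\<i> v\<close>. The residue theorem on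
    \<open>[- \<pi>, \<pi>] \<times> [- n, n]\<close> gives the claim: the vertical edges carry the density and the horizontal
    ones vanish in the limit.\<close>
  define f where "f z = 1 / (of_real c + exp (- \<i> * of_real b * z))" for z :: complex
  define g where "g z = 1 - exp (of_real v + \<i> * z)" for z :: complex
  \<comment> \<open>The strip must be wider than \<open>pi\<close> to contain the rectangle. The
    bound \<open>2 * pi\<close> excludes the other zeros of \<open>g\<close>, and
    \<open>pi / b\<close>, which exceeds \<open>pi\<close> because \<open>b < 1\<close>, excludes
    the poles of \<open>f\<close>.\<close>
  define r where "r = (pi + min (2 * pi) (pi / b)) / 2"
  have r: "pi < r" "r < 2 * pi" "r < pi / b"
    using b by (auto simp: r_def min_def field_simps)
  define S where "S = {z. \<bar>Re z\<bar> < r}"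
  have S_eq: "S = {z. Re z < r} \<inter> {z. - r < Re z}"
    by (auto simp: S_def)
  have "open S"
    unfolding S_eq by (intro open_Int open_halfspace_Re_lt open_halfspace_Re_gt)
  have "convex S"
    unfolding S_eq by (intro convex_Int convex_halfspace_Re_lt convex_halfspace_Re_gt)
  have f_nz: "of_real c + exp (- \<i> * of_real b * z) \<noteq> 0" if "z \<in> S" for z
  proof (rule of_real_plus_exp_nonzero)
    have "b * \<bar>Re z\<bar> < b * (pi / b)"
      using that r b by (intro mult_strict_left_mono) (auto simp: S_def)
    then show "\<bar>Im (- \<i> * of_real b * z)\<bar> < pi"
      using b by (simp add: abs_mult)
  qed (fact c)
  have g_nz: "g z \<noteq> 0" if "z \<in> S" "z \<noteq> \<i> * of_real v" for z
  proof
    assume "g z = 0"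
    then have "exp (of_real v + \<i> * z) = 1"
      by (simp add: g_def)
    then obtain n :: int where n: "v = Im z" "Re z = of_int (2 * n) * pi"
      by (auto simp: exp_eq_1)
    with that r have "\<bar>of_int (2 * n) * pi\<bar> < 2 * pi"
      by (simp add: S_def)
    then have "\<bar>of_int n\<bar> < (1 :: real)"
      by (simp add: abs_mult)
    then have "n = 0"
      by linarith
    with n that(2) show False
      by (auto simp: complex_eq_iff)
  qed
  have f_holo: "f holomorphic_on S"
    unfolding f_def using f_nz by (intro holomorphic_intros) auto
  have g_holo: "g holomorphic_on S"
    unfolding g_def by (intro holomorphic_intros)
  have v_S: "\<i> * of_real v \<in> S"
    using r pi_gt_zero by (simp add: S_def)
  have f_v: "f (\<i> * of_real v) = of_real (1 / (c + exp (b * v)))"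
    by (simp add: f_def mult_ac flip: exp_of_real)
  have res: "residue (\<lambda>z. f z / g z) (\<i> * of_real v) = f (\<i> * of_real v) / (- \<i>)"
  proof (rule residue_simple_pole_deriv[OF f_holo g_holo \<open>open S\<close> _ v_S])
    show "connected S"
      using \<open>convex S\<close> by (rule convex_connected)
    show "(g has_field_derivative - \<i>) (at (\<i> * of_real v))"
      unfolding g_def by (auto intro!: derivative_eq_intros)
    show "f (\<i> * of_real v) \<noteq> 0"
      using c f_nz[OF v_S] by (simp add: f_def)
  qed (auto simp: g_def)
  \<comment> \<open>\<open>I n\<close> belongs to the right vertical edge, up to the factor
    \<open>\<i>\<close> from the parametrization; \<open>E n\<close> collects the two horizontal
    edges.\<close>
  define I where "I n = integral {- real n..real n} (\<lambda>u. f (Complex pi u) / g (Complex pi u))" for n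
  define E where "E n = contour_integral (linepath (Complex (- pi) (- real n)) (Complex pi (- real n))) (\<lambda>z. f z / g z)
      + contour_integral (linepath (Complex pi (real n)) (Complex (- pi) (real n))) (\<lambda>z. f z / g z)" for n
  have cont: "continuous_on A (\<lambda>z. f z / g z)" if "A \<subseteq> S" "\<i> * of_real v \<notin> A" for A
    using that g_nz f_holo g_holo
    by (intro continuous_on_divide) (auto intro: holomorphic_on_imp_continuous_on continuous_on_subset)
  have pi_S: "Complex pi u \<in> S" "Complex (- pi) u \<in> S" for u
    using r by (auto simp: S_def)
  \<comment> \<open>Reflection in the imaginary axis conjugates the integrand. The two vertical
    edges, run in opposite directions, thus combine to \<open>\<i> * (I n - cnj (I n))\<close>, that
    is \<open>- 2 * Im (I n)\<close>.\<close>
  have f_cnj: "f (Complex (- pi) u) / g (Complex (- pi) u) = cnj (f (Complex pi u) / g (Complex pi u))" for u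
  proof -
    have "of_real v + \<i> * Complex (- pi) u = cnj (of_real v + \<i> * Complex pi u)"
      and "- \<i> * of_real b * Complex (- pi) u = cnj (- \<i> * of_real b * Complex pi u)"
      by (simp_all add: complex_eq_iff)
    then show ?thesis
      by (simp only: f_def g_def complex_cnj_divide complex_cnj_add complex_cnj_diff complex_cnj_one
          complex_cnj_complex_of_real exp_cnj)
  qed
  \<comment> \<open>On this edge \<open>exp (\<i> * pi) = -1\<close> turns \<open>g\<close> into the
    positive real number \<open>1 + exp (v - u)\<close>, so the imaginary part comes from
    \<open>f\<close> alone.\<close>
  have Im_fg: "Im (f (Complex pi u) / g (Complex pi u)) = pi * (stieltjes_density b c u / (1 + exp (v - u)))" for u
  proof -
    have "of_real v + \<i> * Complex pi u = of_real (v - u) + \<i> * of_real pi"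
      by (simp add: complex_eq_iff)
    then have "exp (of_real v + \<i> * Complex pi u) = of_real (exp (v - u)) * exp (\<i> * of_real pi)"
      by (simp only: exp_add exp_of_real)
    then have "g (Complex pi u) = of_real (1 + exp (v - u))"
      by (simp only: g_def exp_pi_i') simp
    moreover have "- \<i> * of_real b * Complex pi u = Complex (b * u) (- (b * pi))"
      by (simp add: complex_eq_iff)
    ultimately show ?thesis
      by (simp only: f_def Im_divide_of_real stieltjes_density_def) simp
  qed
  have eq: "- 2 * of_real pi * f (\<i> * of_real v) = - 2 * of_real (Im (I n)) + E n" if n: "real n > \<bar>v\<bar>" for n
  proof -
    let ?a = "Complex (- pi) (- real n)" and ?b = "Complex pi (real n)"
    let ?F = "\<lambda>z. f z / g z"
    have n0: "- real n < real n"
      using n by linarith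
    have seg: "closed_segment x y \<subseteq> S - {\<i> * of_real v}"
      if "\<bar>Re x\<bar> \<le> pi" "\<bar>Re y\<bar> \<le> pi" "(Re x = Re y \<and> Re x \<noteq> 0) \<or> (Im x = Im y \<and> Im x \<noteq> v)" for x y
    proof -
      have "closed_segment x y \<subseteq> S"
        using that r by (intro closed_segment_subset \<open>convex S\<close>) (auto simp: S_def)
      moreover have "\<i> * of_real v \<notin> closed_segment x y"
        using that(3) by (auto simp: closed_segment_same_Re closed_segment_same_Im)
      ultimately show ?thesis
        by blast
    qed
    have int: "?F contour_integrable_on linepath x y"
      if "\<bar>Re x\<bar> \<le> pi" "\<bar>Re y\<bar> \<le> pi" "(Re x = Re y \<and> Re x \<noteq> 0) \<or> (Im x = Im y \<and> Im x \<noteq> v)" for x y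
      using seg[OF that] by (intro contour_integrable_continuous_linepath cont) auto
    have "contour_integral (rectpath ?a ?b) ?F
        = 2 * pi * \<i> * (\<Sum>p\<in>{\<i> * of_real v}. winding_number (rectpath ?a ?b) p * residue ?F p)"
    proof (rule Residue_theorem[OF \<open>open S\<close>])
      show "connected S"
        using \<open>convex S\<close> by (rule convex_connected)
      show "?F holomorphic_on S - {\<i> * of_real v}"
        using g_nz by (intro holomorphic_on_divide holomorphic_on_subset[OF f_holo]
            holomorphic_on_subset[OF g_holo]) auto
      show "path_image (rectpath ?a ?b) \<subseteq> S - {\<i> * of_real v}"
        using r n by (auto simp: path_image_rectpath S_def)
      have "cbox ?a ?b \<subseteq> S"
        using r by (auto simp: S_def in_cbox_complex_iff)
      then show "\<forall>z. z \<notin> S \<longrightarrow> winding_number (rectpath ?a ?b) z = 0"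
        by (intro allI impI winding_number_rectpath_outside) auto
    qed auto
    also have "\<dots> = - 2 * of_real pi * f (\<i> * of_real v)"
    proof -
      have "winding_number (rectpath ?a ?b) (\<i> * of_real v) = 1"
        using n by (intro winding_number_rectpath) (auto simp: in_box_complex_iff)
      then have "(\<Sum>p\<in>{\<i> * of_real v}. winding_number (rectpath ?a ?b) p * residue ?F p)
          = f (\<i> * of_real v) / (- \<i>)"
        using res by simp
      moreover have "2 * pi * \<i> * (w / (- \<i>)) = - 2 * of_real pi * w" for w :: complex
        by (simp add: field_simps)
      ultimately show ?thesis
        by (simp only:)
    qed
    also have "contour_integral (rectpath ?a ?b) ?F = E n
        + contour_integral (linepath (Complex pi (- real n)) ?b) ?F
        + contour_integral (linepath (Complex (- pi) (real n)) ?a) ?F"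
    proof -
      have "?F contour_integrable_on linepath ?a (Complex pi (- real n))"
        "?F contour_integrable_on linepath (Complex pi (- real n)) ?b"
        "?F contour_integrable_on linepath ?b (Complex (- pi) (real n))"
        "?F contour_integrable_on linepath (Complex (- pi) (real n)) ?a"
        using n by (intro int; simp)+
      then show ?thesis
        by (simp add: rectpath_def Let_def contour_integral_join contour_integrable_joinI E_def)
    qed
    also have "contour_integral (linepath (Complex pi (- real n)) ?b) ?F = \<i> * I n"
      using n0 by (simp add: contour_integral_linepath_same_Re I_def)
    also have "contour_integral (linepath (Complex (- pi) (real n)) ?a) ?F
        = - contour_integral (linepath ?a (Complex (- pi) (real n))) ?F"
      using seg[of "Complex (- pi) (real n)" ?a] by (intro contour_integral_reverse_linepath cont) auto
    also have "contour_integral (linepath ?a (Complex (- pi) (real n))) ?F = \<i> * cnj (I n)"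
      using n0 by (simp add: contour_integral_linepath_same_Re f_cnj I_def integral_cnj)
    finally show ?thesis
      by (simp add: complex_eq_iff)
  qed
  have ImI: "Im (I n) = pi * integral {- real n..real n} (\<lambda>u. stieltjes_density b c u / (1 + exp (v - u)))" for n
  proof -
    have "(\<lambda>u. f (Complex pi u) / g (Complex pi u)) integrable_on {- real n..real n}"
      unfolding Complex_eq
      by (intro integrable_continuous_interval
           continuous_on_compose2[OF cont[of "range (\<lambda>u. Complex pi u)", unfolded Complex_eq]] continuous_intros)
        (use pi_S in \<open>auto simp: Complex_eq complex_eq_iff\<close>)
    then have "Im (I n) = integral {- real n..real n} (\<lambda>u. Im (f (Complex pi u) / g (Complex pi u)))"
      unfolding I_def by (rule integral_linear[OF _ bounded_linear_Im, unfolded o_def, symmetric])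
    then show ?thesis
      by (simp only: Im_fg integral_mult_right)
  qed
  \<comment> \<open>Bound for the integrand on the line \<open>Im z = T\<close>, from the reverse
    triangle inequality in both denominators. As \<open>T\<close> tends to plus infinity the first
    factor blows up, as \<open>T\<close> tends to minus infinity the second.\<close>
  define B where "B T = 1 / (\<bar>c - exp (b * T)\<bar> * \<bar>1 - exp (v - T)\<bar>)" for T :: real
  have B: "(\<lambda>n. B (real n)) \<longlonglongrightarrow> 0" "(\<lambda>n. B (- real n)) \<longlonglongrightarrow> 0"
    unfolding B_def using b c by real_asymp+
  have fg_bound: "norm (f z / g z) \<le> B (Im z)" if "exp (b * Im z) \<noteq> c" "Im z \<noteq> v" for z
  proof -
    have "\<bar>c - exp (b * Im z)\<bar> \<le> norm (of_real c + exp (- \<i> * of_real b * z))"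
      using norm_triangle_ineq3[of "of_real c" "- exp (- \<i> * of_real b * z)"] c by simp
    moreover have "\<bar>1 - exp (v - Im z)\<bar> \<le> norm (g z)"
      using norm_triangle_ineq3[of 1 "exp (of_real v + \<i> * z)"] by (simp add: g_def)
    ultimately have "\<bar>c - exp (b * Im z)\<bar> * \<bar>1 - exp (v - Im z)\<bar>
        \<le> norm (of_real c + exp (- \<i> * of_real b * z)) * norm (g z)"
      by (intro mult_mono) auto
    moreover have "0 < \<bar>c - exp (b * Im z)\<bar> * \<bar>1 - exp (v - Im z)\<bar>"
      using that by simp
    ultimately have "1 / (norm (of_real c + exp (- \<i> * of_real b * z)) * norm (g z)) \<le> B (Im z)"
      unfolding B_def by (intro divide_left_mono[OF _ _ mult_pos_pos]) linarith+
    then show ?thesis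
      by (simp add: f_def norm_divide norm_mult)
  qed
  have E_bound: "norm (E n) \<le> (B (real n) + B (- real n)) * (2 * pi)"
    if n: "real n > \<bar>v\<bar>" "exp (b * real n) > c" "exp (- b * real n) < c" for n
  proof -
    have edge: "norm (contour_integral (linepath (Complex x T) (Complex y T)) (\<lambda>z. f z / g z)) \<le> B T * (2 * pi)"
      if T: "exp (b * T) \<noteq> c" "T \<noteq> v" and xy: "(x = - pi \<and> y = pi) \<or> (x = pi \<and> y = - pi)" for x y T
    proof -
      have "closed_segment (Complex x T) (Complex y T) \<subseteq> S"
        using xy pi_S by (intro closed_segment_subset \<open>convex S\<close>) auto
      moreover have "norm (f z / g z) \<le> B T" if "z \<in> closed_segment (Complex x T) (Complex y T)" for z
        using fg_bound[of z] that T by (auto simp: closed_segment_same_Im)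
      moreover have "0 \<le> B T"
        by (simp add: B_def)
      ultimately have "norm (contour_integral (linepath (Complex x T) (Complex y T)) (\<lambda>z. f z / g z))
          \<le> B T * norm (Complex y T - Complex x T)"
        using T by (intro contour_integral_bound_linepath contour_integrable_continuous_linepath cont)
          (auto simp: closed_segment_same_Im)
      moreover have "norm (Complex y T - Complex x T) = 2 * pi"
      proof -
        have "Complex y T - Complex x T = of_real (y - x)"
          by (simp add: complex_eq_iff)
        then show ?thesis
          using xy by (auto simp del: of_real_diff)
      qed
      ultimately show ?thesis
        by simp
    qed
    have "norm (E n) \<le> B (- real n) * (2 * pi) + B (real n) * (2 * pi)"
      unfolding E_def using n by (intro norm_triangle_mono edge) auto
    then show ?thesis
      by (simp only: distrib_right add.commute)
  qed
  have "E \<longlonglongrightarrow> 0"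
  proof (rule Lim_null_comparison)
    have "eventually (\<lambda>n. real n > \<bar>v\<bar>) sequentially" "eventually (\<lambda>n. exp (b * real n) > c) sequentially"
      "eventually (\<lambda>n. exp (- b * real n) < c) sequentially"
      using b c by real_asymp+
    then show "\<forall>\<^sub>F n in sequentially. norm (E n) \<le> (B (real n) + B (- real n)) * (2 * pi)"
      by eventually_elim (rule E_bound)
    show "(\<lambda>n. (B (real n) + B (- real n)) * (2 * pi)) \<longlonglongrightarrow> 0"
      using B by (auto intro!: tendsto_eq_intros)
  qed
  then have "(\<lambda>n. Re (E n) / (2 * pi) + 1 / (c + exp (b * v))) \<longlonglongrightarrow> 1 / (c + exp (b * v))"
    by (auto intro!: tendsto_eq_intros)
  moreover have "\<forall>\<^sub>F n in sequentially. Re (E n) / (2 * pi) + 1 / (c + exp (b * v))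
      = integral {- real n..real n} (\<lambda>u. stieltjes_density b c u / (1 + exp (v - u)))"
  proof -
    have "eventually (\<lambda>n. real n > \<bar>v\<bar>) sequentially"
      by real_asymp
    then show ?thesis
    proof eventually_elim
      case (elim n)
      have "- 2 * pi * (1 / (c + exp (b * v))) = - 2 * Im (I n) + Re (E n)"
        using arg_cong[OF eq[OF elim], of Re] by (simp only: f_v) simp
      moreover have "r / (2 * pi) + k = J" if "- 2 * pi * k = - 2 * (pi * J) + r" for r k J :: real
        using that by (simp add: field_simps)
      ultimately show ?case
        unfolding ImI by blast
    qed
  qed
  ultimately show ?thesis
    by (rule Lim_transform_eventually)
qed

text \<open>Because the integrand is nonnegative, monotone convergence upgrades the limit of
  truncated integrals to a Lebesgue integral over the whole line.\<close>

lemma has_bochner_integral_stieltjes_exp: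
  "has_bochner_integral lborel (\<lambda>u. stieltjes_density b c u / (1 + exp (v - u))) (1 / (c + exp (b * v)))"
proof -
  define g where "g u = stieltjes_density b c u / (1 + exp (v - u))" for u
  define f where "f n u = indicator {- real n..real n} u *\<^sub>R g u" for n u
  have pos: "1 + exp y > 0" for y :: real
    by (simp add: add_pos_pos)
  have g_nonneg: "0 \<le> g u" for u
    using stieltjes_density_nonneg pos[of "v - u"] by (simp add: g_def)
  have g_cont: "continuous_on A g" for A
    unfolding g_def using pos
    by (intro continuous_intros continuous_on_stieltjes_density) (auto simp: less_imp_neq[THEN not_sym])
  have g_meas: "g \<in> borel_measurable lborel"
    using g_cont[of UNIV] by (simp add: borel_measurable_continuous_onI)
  have int: "integrable lborel (f n)" for n
    unfolding f_def by (intro borel_integrable_compact g_cont) auto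
  have eq: "integral\<^sup>L lborel (f n) = integral {- real n..real n} g" for n
    using set_borel_integral_eq_integral(2)[of "{- real n..real n}" g] int[of n]
    by (simp add: f_def[abs_def] set_integrable_def set_lebesgue_integral_def)
  have conv: "(\<lambda>n. integral\<^sup>L lborel (f n)) \<longlonglongrightarrow> 1 / (c + exp (b * v))"
    unfolding eq using stieltjes_truncated_integral_tendsto by (simp add: g_def[abs_def])
  have mono: "mono (\<lambda>n. f n u)" for u
    using g_nonneg by (intro monoI) (auto simp: f_def indicator_def)
  have lim: "(\<lambda>n. f n u) \<longlonglongrightarrow> g u" for u
  proof (rule tendsto_eventually)
    have "\<forall>\<^sub>F n in sequentially. \<bar>u\<bar> < real n"
      by real_asymp
    then show "\<forall>\<^sub>F n in sequentially. f n u = g u"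
      by eventually_elim (auto simp: f_def indicator_def)
  qed
  have "integrable lborel g" "integral\<^sup>L lborel g = 1 / (c + exp (b * v))"
    using g_nonneg mono lim
    by (intro integral_monotone_convergence_nonneg[OF int _ _ _ conv g_meas]; simp add: f_def)+
  then show ?thesis
    by (simp add: has_bochner_integral_iff g_def[abs_def])
qed

text \<open>For \<open>l > 0\<close> substitute \<open>v = ln l\<close>. The case
  \<open>l = 0\<close> is the monotone limit along \<open>v = - n\<close>; it says that the density
  has total mass \<open>1 / c\<close>, and this serves the term \<open>n = 0\<close> of the series
  as well as every later domination argument.\<close>

lemma has_bochner_integral_stieltjes:
  assumes "0 \<le> l"
  shows "has_bochner_integral lborel (\<lambda>u. stieltjes_density b c u * (exp u / (exp u + l)))
    (1 / (c + l powr b))"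
proof (cases "l = 0")
  case False
  have "1 / (1 + exp (ln l - u)) = exp u / (exp u + l)" for u
    using False assms by (simp add: exp_diff field_simps add_pos_pos)
  then have "stieltjes_density b c u / (1 + exp (ln l - u)) = stieltjes_density b c u * (exp u / (exp u + l))" for u
    by (metis divide_inverse mult.commute mult_1 times_divide_eq_right)
  then show ?thesis
    using has_bochner_integral_stieltjes_exp[of "ln l"] False by (simp add: powr_def)
next
  case True
  define f where "f n u = stieltjes_density b c u / (1 + exp (- real n - u))" for n u
  have pos: "1 + exp y > 0" for y :: real
    by (simp add: add_pos_pos)
  have f: "has_bochner_integral lborel (f n) (1 / (c + exp (b * (- real n))))" for n
    unfolding f_def by (rule has_bochner_integral_stieltjes_exp)
  have mono: "mono (\<lambda>n. f n u)" for u
    unfolding f_def using stieltjes_density_nonneg pos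
    by (intro monoI divide_left_mono mult_pos_pos) auto
  have lim: "(\<lambda>n. f n u) \<longlonglongrightarrow> stieltjes_density b c u" for u
  proof -
    have "(\<lambda>n. 1 / (1 + exp (- real n - u))) \<longlonglongrightarrow> 1"
      by real_asymp
    from tendsto_mult_left[OF this, of "stieltjes_density b c u"] show ?thesis
      by (simp add: f_def)
  qed
  have conv: "(\<lambda>n. integral\<^sup>L lborel (f n)) \<longlonglongrightarrow> 1 / c"
    unfolding has_bochner_integral_integral_eq[OF f] inverse_eq_divide[symmetric] using b c by real_asymp
  have "integrable lborel (stieltjes_density b c)" "integral\<^sup>L lborel (stieltjes_density b c) = 1 / c"
  proof -
    have int: "integrable lborel (f n)" for n
      using f by (auto simp: has_bochner_integral_iff)
    have nonneg: "0 \<le> f n u" for n u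
      unfolding f_def using stieltjes_density_nonneg pos[of "- real n - u"] by (intro divide_nonneg_pos)
    have meas: "stieltjes_density b c \<in> borel_measurable lborel"
      by simp
    note mc = integral_monotone_convergence_nonneg[OF int AE_I2[OF mono] AE_I2[OF nonneg] AE_I2[OF lim] conv meas]
    show "integrable lborel (stieltjes_density b c)" "integral\<^sup>L lborel (stieltjes_density b c) = 1 / c"
      by (rule mc)+
  qed
  then show ?thesis
    by (simp add: has_bochner_integral_iff True)
qed

end

section \<open>The Green function\<close>

text \<open>Abel summation: the differences of \<open>a\<close> are nonnegative and, together with
  the last term, telescope to \<open>a 0\<close>. The bound does not depend on the length of the
  sum.\<close>

lemma abs_sum_decseq_le:
  fixes a t :: "nat \<Rightarrow> real"
  assumes "decseq a" and "\<And>n. 0 \<le> a n" and "\<And>n. \<bar>\<Sum>k\<le>n. t k\<bar> \<le> C"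
  shows "\<bar>\<Sum>k\<le>n. a k * t k\<bar> \<le> C * a 0"
proof -
  define B where "B n = (\<Sum>k\<le>n. t k)" for n
  have parts: "(\<Sum>k\<le>n. a k * t k) = a n * B n + (\<Sum>k<n. (a k - a (Suc k)) * B k)"
    by (induction n) (simp_all add: B_def algebra_simps)
  have step: "0 \<le> a k - a (Suc k)" for k
    using assms(1) by (simp add: decseq_Suc_iff)
  have "\<bar>\<Sum>k\<le>n. a k * t k\<bar> \<le> a n * C + (\<Sum>k<n. (a k - a (Suc k)) * C)"
    unfolding parts using assms step
    by (intro order_trans[OF abs_triangle_ineq] order_trans[OF add_mono[OF order_refl sum_abs]]
        add_mono sum_mono) (auto simp: abs_mult B_def intro!: mult_left_mono)
  also have "\<dots> = C * a 0"
  proof -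
    have "a n * C + (\<Sum>k<n. (a k - a (Suc k)) * C) = (a n + (\<Sum>k<n. a k - a (Suc k))) * C"
      by (simp only: sum_distrib_right distrib_right)
    then show ?thesis
      by (simp only: sum_lessThan_telescope') simp
  qed
  finally show ?thesis .
qed

text \<open>Multiplied by \<open>sin (x / 2)\<close>, each term becomes a difference of sines at
  consecutive half-integer frequencies, and the sum telescopes.\<close>

lemma dirichlet_kernel_eq:
  "sin (x / 2) * (\<Sum>k\<le>n. cosine_weight k * cos (real k * x)) = sin ((real n + 1 / 2) * x)"
proof (induction n)
  case 0
  then show ?case
    by (simp add: cosine_weight_def)
next
  case (Suc n)
  have "(real (Suc n) + 1 / 2) * x = real (Suc n) * x + x / 2"
    and "(real n + 1 / 2) * x = real (Suc n) * x - x / 2"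
    by (simp_all add: field_simps)
  then have "sin ((real (Suc n) + 1 / 2) * x) - sin ((real n + 1 / 2) * x) = 2 * sin (x / 2) * cos (real (Suc n) * x)"
    by (simp only: sin_add sin_diff) simp
  then show ?case
    using Suc by (simp add: distrib_left cosine_weight_def del: of_nat_Suc)
qed

lemma dirichlet_kernel_bound:
  assumes "x \<in> {0<..<pi}"
  shows "\<bar>\<Sum>k\<le>n. cosine_weight k * cos (real k * x)\<bar> \<le> 1 / sin (x / 2)"
proof -
  have s: "sin (x / 2) > 0"
    using assms by (intro sin_gt_zero) auto
  then have "(\<Sum>k\<le>n. cosine_weight k * cos (real k * x)) = sin ((real n + 1 / 2) * x) / sin (x / 2)"
    using dirichlet_kernel_eq[of x n] by (simp add: field_simps)
  then show ?thesis
    using s by (simp add: divide_right_mono)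
qed

lemma green_partial_sum_eq:
  "green_partial_sum \<alpha> c N x
    = (\<Sum>n\<le>N. cosine_weight n * cos (real n * x) * (1 / (c + real n powr \<alpha>))) / (2 * pi)"
proof -
  have "(\<Sum>n = - int N..int N. cos (of_int n * x) / (c + \<bar>of_int n\<bar> powr \<alpha>))
      = (\<Sum>n\<le>N. cosine_weight n * cos (real n * x) * (1 / (c + real n powr \<alpha>)))"
  proof (induction N)
    case 0
    then show ?case
      by (simp add: cosine_weight_def)
  next
    case (Suc N)
    let ?g = "\<lambda>n :: int. cos (of_int n * x) / (c + \<bar>of_int n\<bar> powr \<alpha>)"
    have "{- int (Suc N)..int (Suc N)} = insert (- int (Suc N)) (insert (int (Suc N)) {- int N..int N})"
      by auto
    then have "sum ?g {- int (Suc N)..int (Suc N)}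
        = ?g (- int (Suc N)) + (?g (int (Suc N)) + sum ?g {- int N..int N})"
      by (simp del: of_nat_Suc)
    also have "?g (- int (Suc N)) = ?g (int (Suc N))"
      by (simp del: of_nat_Suc)
    also have "?g (int (Suc N)) + (?g (int (Suc N)) + sum ?g {- int N..int N})
        = sum ?g {- int N..int N} + cosine_weight (Suc N) * ?g (int (Suc N))"
      by (simp add: cosine_weight_def del: of_nat_Suc)
    finally show ?case
      unfolding Suc by (simp del: of_nat_Suc)
  qed
  then show ?thesis
    by (simp add: green_partial_sum_def)
qed

text \<open>Normalised so that \<open>s\<^sup>2\<close> times the Green function for \<open>\<alpha> = 2\<close>, \<open>c = s\<^sup>2\<close> is
  \<open>kernel_weight s * (exp (- (s * x)) + exp (- (s * (2 * pi - x))))\<close>.\<close>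

definition kernel_weight :: "real \<Rightarrow> real" where
  "kernel_weight s = s / (2 * (1 - exp (- (2 * pi * s))))"

lemma kernel_weight_nonneg: "s > 0 \<Longrightarrow> 0 \<le> kernel_weight s"
  by (simp add: kernel_weight_def)

text \<open>From \<open>exp y \<ge> 1 + y\<close> at \<open>y = 2 * pi * s\<close>. The bound stays
  finite as \<open>s\<close> tends to 0, where the defining quotient degenerates to 0/0.\<close>

lemma kernel_weight_le:
  assumes "s > 0"
  shows "kernel_weight s \<le> 1 / (4 * pi) + s / 2"
proof -
  define y where "y = 2 * pi * s"
  have y: "y > 0"
    using assms by (simp add: y_def)
  have "exp (- y) \<le> 1 / (1 + y)"
    using exp_ge_add_one_self[of y] y by (simp add: exp_minus field_simps)
  then have "y / (1 + y) \<le> 1 - exp (- y)"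
    using y by (simp add: field_simps)
  then have "s / (2 * (1 - exp (- y))) \<le> s / (2 * (y / (1 + y)))"
    using y assms by (intro divide_left_mono mult_pos_pos) auto
  also have "\<dots> = 1 / (4 * pi) + s / 2"
    using assms y by (simp add: y_def field_simps)
  finally show ?thesis
    by (simp add: kernel_weight_def y_def)
qed

text \<open>The right-hand side is free of \<open>s\<close>, so for fixed \<open>x\<close> a
  constant multiple of the Stieltjes density dominates the mixture.\<close>

lemma kernel_weight_exp_le:
  assumes "s > 0" "x > 0"
  shows "kernel_weight s * exp (- (s * x)) \<le> 1 / (4 * pi) + 1 / (2 * x)"
proof -
  have "s * x \<le> exp (s * x)"
    using exp_ge_add_one_self[of "s * x"] by linarith
  then have "s * exp (- (s * x)) \<le> 1 / x"
    using assms by (simp add: exp_minus field_simps)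
  moreover have "1 / (4 * pi) * exp (- (s * x)) \<le> 1 / (4 * pi) * 1"
    using assms by (intro mult_left_mono) auto
  moreover have "kernel_weight s * exp (- (s * x)) \<le> (1 / (4 * pi) + s / 2) * exp (- (s * x))"
    using assms by (intro mult_right_mono kernel_weight_le) auto
  ultimately show ?thesis
    by (simp add: distrib_right)
qed

lemma cosine_series_limit:
  assumes s: "s > 0" and x: "x \<in> {0<..<pi}"
  shows "(\<lambda>N. (\<Sum>n\<le>N. cosine_weight n * cos (real n * x) * (1 / (s\<^sup>2 + (real n)\<^sup>2))) / (2 * pi))
    \<longlonglongrightarrow> kernel_weight s / s\<^sup>2 * (exp (- (s * x)) + exp (- (s * (2 * pi - x))))"
proof -
  have "(\<lambda>N. \<Sum>n\<le>N. cosine_weight n * cos (real n * x) / (s\<^sup>2 + (real n)\<^sup>2))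
      \<longlonglongrightarrow> pi * cosh (s * (pi - x)) / (s * sinh (s * pi))"
    using cosh_cosine_series[OF s, of x] x by (simp add: sums_def_le)
  then have "(\<lambda>N. (\<Sum>n\<le>N. cosine_weight n * cos (real n * x) / (s\<^sup>2 + (real n)\<^sup>2)) / (2 * pi))
      \<longlonglongrightarrow> pi * cosh (s * (pi - x)) / (s * sinh (s * pi)) / (2 * pi)"
    by (intro tendsto_divide) auto
  moreover have "pi * cosh (s * (pi - x)) / (s * sinh (s * pi)) / (2 * pi)
      = kernel_weight s / s\<^sup>2 * (exp (- (s * x)) + exp (- (s * (2 * pi - x))))"
  proof -
    \<comment> \<open>Expanding the quotient of \<open>cosh\<close> and \<open>sinh\<close> by
      \<open>2 * q\<close> leaves only decaying exponentials.\<close>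
    define q where "q = exp (- (s * pi))"
    have q: "0 < q"
      by (simp add: q_def)
    have "2 * q * cosh (s * (pi - x)) = exp (- (s * x)) + exp (- (s * (2 * pi - x)))"
      by (simp add: q_def cosh_field_def distrib_left mult_exp_exp algebra_simps)
    moreover have "2 * q * sinh (s * pi) = 1 - q\<^sup>2"
    proof -
      have "sinh (s * pi) * 2 = exp (s * pi) - q" "q * exp (s * pi) = 1"
        by (simp_all add: q_def sinh_field_def mult_exp_exp)
      moreover have "2 * q * sinh (s * pi) = q * (sinh (s * pi) * 2)"
        by simp
      ultimately show ?thesis
        by (simp only: right_diff_distrib power2_eq_square)
    qed
    moreover have "exp (- (2 * pi * s)) = q\<^sup>2"
      by (simp add: q_def power2_eq_square mult_exp_exp)
    moreover have "pi * cosh (s * (pi - x)) / (s * sinh (s * pi)) / (2 * pi)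
        = (2 * q * cosh (s * (pi - x))) / (2 * s * (2 * q * sinh (s * pi)))"
      using q s by (simp add: field_simps)
    moreover have "e / (2 * s * d) = s / (2 * d) / s\<^sup>2 * e" for d e :: real
      using s by (simp add: power2_eq_square)
    ultimately show ?thesis
      by (simp only: kernel_weight_def)
  qed
  ultimately show ?thesis
    by simp
qed

section \<open>The endpoint \<open>\<alpha> = 2\<close> and the mixture for
  \<open>\<alpha> < 2\<close>\<close>

text \<open>Here no mixing takes place: the Laplace transform is that of a point mass at
  \<open>sqrt c\<close>, modelled on a one-point measure space.\<close>

lemma completely_monotone_green_two:
  assumes "0 < c"
  shows "completely_monotone_on {0<..<pi} (green 2 c)"
proof (rule completely_monotone_on_laplace_symmetrized)
  define s where "s = sqrt c"
  have s: "s > 0" "s\<^sup>2 = c"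
    using assms by (auto simp: s_def)
  let ?M = "count_space {()}" and ?w = "\<lambda>_ :: unit. kernel_weight s / s\<^sup>2" and ?s = "\<lambda>_ :: unit. s"
  show "?w \<in> borel_measurable ?M" "?s \<in> borel_measurable ?M"
    by auto
  show "0 \<le> ?s u" "0 \<le> ?w u" for u
    using s by (auto simp: kernel_weight_nonneg)
  show "integrable ?M (\<lambda>u. ?w u * exp (- (?s u * x)))" for x
    by (intro integrable_count_space) auto
  fix x assume x: "0 < x" "x < pi"
  have "green_partial_sum 2 c N x
      = (\<Sum>n\<le>N. cosine_weight n * cos (real n * x) * (1 / (s\<^sup>2 + (real n)\<^sup>2))) / (2 * pi)" for N
    unfolding green_partial_sum_eq by (simp add: s)
  then have "(\<lambda>N. green_partial_sum 2 c N x) \<longlonglongrightarrow> kernel_weight s / s\<^sup>2 * (exp (- (s * x)) + exp (- (s * (2 * pi - x))))"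
    using cosine_series_limit[OF s(1), of x] x by simp
  then show "green 2 c x = (\<integral>u. ?w u * (exp (- (?s u * x)) + exp (- (?s u * (2 * pi - x)))) \<partial>?M)"
    unfolding green_def by (simp add: limI lebesgue_integral_count_space_finite)
qed

text \<open>Finite partial sums are represented termwise. Dominated convergence then passes to the
  limit, using the conditionally convergent series only through a uniform bound on its partial
  sums.\<close>

lemma green_stieltjes_integral:
  assumes "0 < b" "b < 1" "0 < c" and x: "x \<in> {0<..<pi}"
  shows "green (2 * b) c x = (\<integral>u. stieltjes_density b c u * kernel_weight (exp (u / 2))
    * (exp (- (exp (u / 2) * x)) + exp (- (exp (u / 2) * (2 * pi - x)))) \<partial>lborel)"
proof -
  have [measurable]: "stieltjes_density b c \<in> borel_measurable borel"
    by (rule borel_measurable_stieltjes_density[OF assms(1-3)])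
  define P where "P N u = (\<Sum>n\<le>N. cosine_weight n * cos (real n * x) * (exp u / (exp u + (real n)\<^sup>2))) / (2 * pi)" for N u
  \<comment> \<open>The Dirichlet kernel bound divided by \<open>2 * pi\<close>. The factors
    \<open>exp u / (exp u + n ^ 2)\<close> decrease in \<open>n\<close> from the value 1, so Abel
    summation makes \<open>C\<close> a bound for all \<open>N\<close> and \<open>u\<close> at
    once.\<close>
  define C where "C = 1 / sin (x / 2) / (2 * pi)"
  have P_int: "has_bochner_integral lborel (\<lambda>u. stieltjes_density b c u * P N u) (green_partial_sum (2 * b) c N x)" for N
  proof -
    have "has_bochner_integral lborel
      (\<lambda>u. (\<Sum>n\<le>N. cosine_weight n * cos (real n * x) * (stieltjes_density b c u * (exp u / (exp u + (real n)\<^sup>2)))) / (2 * pi))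
      ((\<Sum>n\<le>N. cosine_weight n * cos (real n * x) * (1 / (c + (real n)\<^sup>2 powr b))) / (2 * pi))"
      using assms by (intro has_bochner_integral_divide_zero has_bochner_integral_sum
          has_bochner_integral_mult_right has_bochner_integral_stieltjes) auto
    moreover have "(real n)\<^sup>2 powr b = real n powr (2 * b)" for n
      by (simp add: powr_powr flip: powr_numeral)
    ultimately show ?thesis
      by (simp add: green_partial_sum_eq P_def sum_distrib_left mult_ac)
  qed
  have P_bound: "\<bar>P N u\<bar> \<le> C" for N u
  proof -
    define a where "a n = exp u / (exp u + (real n)\<^sup>2)" for n
    have "\<bar>\<Sum>n\<le>N. a n * (cosine_weight n * cos (real n * x))\<bar> \<le> 1 / sin (x / 2) * a 0"
    proof (rule abs_sum_decseq_le)
      show "decseq a"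
        unfolding a_def by (intro decseq_SucI divide_left_mono add_left_mono mult_pos_pos add_pos_nonneg power_mono) auto
    qed (auto simp: a_def intro!: divide_nonneg_nonneg dirichlet_kernel_bound[OF x])
    then have "\<bar>\<Sum>n\<le>N. a n * (cosine_weight n * cos (real n * x))\<bar> / (2 * pi)
        \<le> 1 / sin (x / 2) * a 0 / (2 * pi)"
      by (rule divide_right_mono) simp
    moreover have "P N u = (\<Sum>n\<le>N. a n * (cosine_weight n * cos (real n * x))) / (2 * pi)"
      by (simp add: P_def a_def mult_ac)
    moreover have "a 0 = 1"
      by (simp add: a_def)
    ultimately show ?thesis
      by (simp add: C_def)
  qed
  have P_lim: "(\<lambda>N. P N u) \<longlonglongrightarrow> kernel_weight (exp (u / 2))
      * (exp (- (exp (u / 2) * x)) + exp (- (exp (u / 2) * (2 * pi - x))))" for u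
  proof -
    define s where "s = exp (u / 2)"
    have s: "s > 0" "s\<^sup>2 = exp u"
      by (auto simp: s_def power2_eq_square mult_exp_exp)
    have "(\<lambda>N. s\<^sup>2 * ((\<Sum>n\<le>N. cosine_weight n * cos (real n * x) * (1 / (s\<^sup>2 + (real n)\<^sup>2))) / (2 * pi)))
      \<longlonglongrightarrow> s\<^sup>2 * (kernel_weight s / s\<^sup>2 * (exp (- (s * x)) + exp (- (s * (2 * pi - x)))))"
      by (intro tendsto_mult_left cosine_series_limit s x)
    moreover have "s\<^sup>2 * ((\<Sum>n\<le>N. cosine_weight n * cos (real n * x) * (1 / (s\<^sup>2 + (real n)\<^sup>2))) / (2 * pi)) = P N u" for N
      by (simp add: P_def s sum_distrib_left mult_ac)
    ultimately show ?thesis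
      using s(1) by (simp add: s_def[symmetric])
  qed
  have dens_int: "integrable lborel (stieltjes_density b c)"
    using has_bochner_integral_stieltjes[OF assms(1-3), of 0] by (simp add: has_bochner_integral_iff)
  have "(\<lambda>N. \<integral>u. stieltjes_density b c u * P N u \<partial>lborel)
      \<longlonglongrightarrow> (\<integral>u. stieltjes_density b c u * (kernel_weight (exp (u / 2))
    * (exp (- (exp (u / 2) * x)) + exp (- (exp (u / 2) * (2 * pi - x))))) \<partial>lborel)"
  proof (rule integral_dominated_convergence)
    show "integrable lborel (\<lambda>u. stieltjes_density b c u * C)"
      using dens_int by simp
    show "AE u in lborel. (\<lambda>N. stieltjes_density b c u * P N u) \<longlonglongrightarrow> stieltjes_density b c u * (kernel_weight (exp (u / 2))
        * (exp (- (exp (u / 2) * x)) + exp (- (exp (u / 2) * (2 * pi - x)))))"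
      by (intro AE_I2 tendsto_mult_left P_lim)
    show "AE u in lborel. norm (stieltjes_density b c u * P N u) \<le> stieltjes_density b c u * C" for N
      using P_bound stieltjes_density_nonneg[OF assms(1-3)]
      by (intro AE_I2) (auto simp: abs_mult intro!: mult_left_mono)
    show "(\<lambda>u. stieltjes_density b c u * P N u) \<in> borel_measurable lborel" for N
      using P_int[of N] by (auto simp: has_bochner_integral_iff)
  qed (simp add: kernel_weight_def)
  then show ?thesis
    unfolding green_def by (simp add: has_bochner_integral_integral_eq[OF P_int] limI mult.assoc)
qed

theorem mainTheorem1:
  fixes \<alpha> c :: real
  assumes "0 < \<alpha>" and "\<alpha> \<le> 2" and "0 < c"
  shows "completely_monotone_on {0<..<pi} (green \<alpha> c)"
proof (cases "\<alpha> = 2")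
  case True
  then show ?thesis
    using completely_monotone_green_two assms by simp
next
  case False
  define b where "b = \<alpha> / 2"
  have b: "0 < b" "b < 1" "\<alpha> = 2 * b"
    using assms False by (auto simp: b_def)
  note density = b(1,2) assms(3)
  let ?s = "\<lambda>u :: real. exp (u / 2)"
  let ?w = "\<lambda>u. stieltjes_density b c u * kernel_weight (?s u)"
  have [measurable]: "stieltjes_density b c \<in> borel_measurable borel"
    by (rule borel_measurable_stieltjes_density[OF density])
  have w_meas: "?w \<in> borel_measurable lborel"
    unfolding kernel_weight_def by measurable
  have w_nonneg: "0 \<le> ?w u" for u
    by (intro mult_nonneg_nonneg stieltjes_density_nonneg[OF density] kernel_weight_nonneg) auto
  have dens_int: "integrable lborel (stieltjes_density b c)"
    using has_bochner_integral_stieltjes[OF density, of 0] by (simp add: has_bochner_integral_iff)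
  \<comment> \<open>\<open>kernel_weight\<close> grows like \<open>s / 2\<close>, so the weight
    alone need not be integrable; the exponential with \<open>x > 0\<close> absorbs the
    growth.\<close>
  have int: "integrable lborel (\<lambda>u. ?w u * exp (- (?s u * x)))" if x: "x > 0" for x
  proof (rule Bochner_Integration.integrable_bound)
    show "integrable lborel (\<lambda>u. stieltjes_density b c u * (1 / (4 * pi) + 1 / (2 * x)))"
      using dens_int by (rule integrable_mult_left)
    show "(\<lambda>u. ?w u * exp (- (?s u * x))) \<in> borel_measurable lborel"
      using w_meas by measurable
    show "AE u in lborel. norm (?w u * exp (- (?s u * x)))
        \<le> norm (stieltjes_density b c u * (1 / (4 * pi) + 1 / (2 * x)))"
    proof (rule AE_I2)
      fix u
      have "0 \<le> kernel_weight (?s u) * exp (- (?s u * x))"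
        using kernel_weight_nonneg[of "?s u"] by simp
      then have "\<bar>kernel_weight (?s u) * exp (- (?s u * x))\<bar> \<le> \<bar>1 / (4 * pi) + 1 / (2 * x)\<bar>"
        using kernel_weight_exp_le[of "?s u" x] x by simp
      from mult_left_mono[OF this, of "\<bar>stieltjes_density b c u\<bar>"]
      show "norm (?w u * exp (- (?s u * x))) \<le> norm (stieltjes_density b c u * (1 / (4 * pi) + 1 / (2 * x)))"
        by (simp only: abs_ge_zero real_norm_def abs_mult mult.assoc)
    qed
  qed
  show ?thesis
    unfolding b(3)
    by (rule completely_monotone_on_laplace_symmetrized[OF w_meas _ _ int w_nonneg
          green_stieltjes_integral[OF density]]) auto
qed

end
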